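(* Let $d$ be even, let $\nu\in(0,1]$, and let $\mathbb V$ be an alternating sine-shear flow on $\mathbb T^d$ having the enhanced dissipation property with constants $C_{\rm ED}\ge1$, $\delta_{\rm ED}\in(0,1)$ described in the context. Let $F=e^{-\mathbb W}\in C^3(\mathbb T^d)$ satisfy $\min_{\mathbf x}F(\mathbf x)\ge1$, and put $M:=\|F\|_{L^1(\mathbb T^d)}$. Let $\omega$ be the solution of $$\partial_t\omega+\mathbb V\cdot\nabla_{\mathbf x}\omega-\omega\,\mathbb V\cdot\nabla_{\mathbf x}\mathbb W=\nu e^{\mathbb W}\Delta_{\mathbf x}(\omega e^{-\mathbb W}),\qquad\omega(t=0,\mathbf x)\equiv|\mathbb T|^d,\quad(t,\mathbf x)\in\mathbb R_+\times\mathbb T^d.$$ Then $$\|\omega(t)e^{-\mathbb W}-M\|_{L^2(\mathbb T^d)}\le C\,\big\||\mathbb T|^de^{-\mathbb W}-M\big\|_{L^2(\mathbb T^d)}\,e^{-\delta_{\rm ED}\nu^{1/2}t}\qquad\text{for all }t\ge0,$$ where the constant $C$ is independent of $\nu$, $t$ and $F$.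
   Context: $\mathbb T=\mathbb R/2\pi\mathbb Z$, $|\mathbb T|=2\pi$. Write $d=2n$, let $\{\mathbf e_j\}$ be the canonical basis of $\mathbb R^d$, and put $\mathbf u_1(\mathbf x)=\sum_{j=1}^n\sin(x_{n+j})\mathbf e_j$, $\mathbf u_2(\mathbf x)=\sum_{j=1}^n\sin(x_j)\mathbf e_{n+j}$. An alternating sine-shear flow is a field $\mathbb V(t,\mathbf x)=\Phi^{(1)}(t)\mathbf u_1(\mathbf x)+\Phi^{(2)}(t)\mathbf u_2(\mathbf x)$ (which is divergence-free) with smooth $\Phi^{(i)}:[0,\infty)\to[0,1]$ varying on a time scale $\mathcal O(\nu^{-1/2})$. The enhanced dissipation property with constants $C_{\rm ED},\delta_{\rm ED}$ (which are independent of $\nu$ and $d$) is: every solution of $\partial_t\eta+\mathbb V\cdot\nabla\eta=\nu\Delta\eta$ on $\mathbb T^d$ with $\eta(0)\in L^2$ satisfies $\|\eta(s+t)-\overline\eta(s+t)\|_{L^2}\le C_{\rm ED}\|\eta(s)-\overline\eta(s)\|_{L^2}e^{-\delta_{\rm ED}\nu^{1/2}t}$ for all $s,t\ge0$, where $\overline\eta=|\mathbb T|^{-d}\int_{\mathbb T^d}\eta\,d\mathbf x$. (Such flows exist for every $\nu\in(0,1]$ and even $d$.) *)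

theory Defs
  imports "HOL-Analysis.Analysis"
begin

text \<open>Functions on \<open>\<real>^d\<close> that are \<open>2\<pi>\<close>-periodic in every coordinate represent the functions
  on the torus; integrals over the torus are Lebesgue integrals over a period cell.\<close>

definition torus_periodic :: "(real^'d \<Rightarrow> 'b) \<Rightarrow> bool" where
  "torus_periodic f \<longleftrightarrow> (\<forall>x i. f (x + axis i (2 * pi)) = f x)"

definition torus_measure :: "(real^'d) measure" where
  "torus_measure = lebesgue_on (cbox 0 (\<chi> i. 2 * pi))"

definition torus_volume :: "'d::finite itself \<Rightarrow> real" where
  "torus_volume _ = (2 * pi) ^ CARD('d)"

definition torus_L2 :: "(real^'d \<Rightarrow> real) \<Rightarrow> bool" where
  "torus_L2 f \<longleftrightarrow> f \<in> borel_measurable torus_measure \<and> integrable torus_measure (\<lambda>x. (f x)\<^sup>2)"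

definition L1_norm :: "(real^'d \<Rightarrow> real) \<Rightarrow> real" where
  "L1_norm f = (\<integral>x. \<bar>f x\<bar> \<partial>torus_measure)"

definition L2_norm :: "(real^'d \<Rightarrow> real) \<Rightarrow> real" where
  "L2_norm f = sqrt (\<integral>x. (f x)\<^sup>2 \<partial>torus_measure)"

definition torus_mean :: "(real^'d \<Rightarrow> real) \<Rightarrow> real" where
  "torus_mean f = (\<integral>x. f x \<partial>torus_measure) / torus_volume TYPE('d)"

definition pderivative :: "'d \<Rightarrow> (real^'d \<Rightarrow> real) \<Rightarrow> real^'d \<Rightarrow> real" where
  "pderivative i f x = frechet_derivative f (at x) (axis i 1)"

definition grad :: "(real^'d \<Rightarrow> real) \<Rightarrow> real^'d \<Rightarrow> real^'d" where
  "grad f x = (\<chi> i. pderivative i f x)"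

definition laplacian :: "(real^'d \<Rightarrow> real) \<Rightarrow> real^'d \<Rightarrow> real" where
  "laplacian f x = (\<Sum>i\<in>UNIV. pderivative i (pderivative i f) x)"

text \<open>\<open>C_diff k f\<close>: \<open>f\<close> is \<open>k\<close> times continuously differentiable on the whole space.\<close>

fun C_diff :: "nat \<Rightarrow> (real^'d \<Rightarrow> real) \<Rightarrow> bool" where
  "C_diff 0 f \<longleftrightarrow> continuous_on UNIV f"
| "C_diff (Suc k) f \<longleftrightarrow> f differentiable_on UNIV \<and> (\<forall>i. C_diff k (pderivative i f))"

text \<open>Derivatives at \<open>0\<close> are one-sided; values at negative times play no role.\<close>

definition smooth_on_halfline :: "(real \<Rightarrow> real) \<Rightarrow> bool" where
  "smooth_on_halfline \<Phi> \<longleftrightarrow> (\<exists>D :: nat \<Rightarrow> real \<Rightarrow> real. D 0 = \<Phi> \<and>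
     (\<forall>k. \<forall>t\<ge>0. (D k has_real_derivative D (Suc k) t) (at t within {0..})))"

text \<open>In dimension \<open>d = 2n\<close> the coordinates are indexed by \<open>'n + 'n\<close>: for \<open>j\<close> in \<open>'n\<close>,
  \<open>Inl j\<close> stands for the index \<open>j\<close> and \<open>Inr j\<close> for \<open>n + j\<close>.\<close>

definition shear1 :: "real^('n::finite + 'n) \<Rightarrow> real^('n + 'n)" where
  "shear1 x = (\<Sum>j\<in>UNIV. sin (x $ Inr j) *\<^sub>R axis (Inl j) 1)"

definition shear2 :: "real^('n::finite + 'n) \<Rightarrow> real^('n + 'n)" where
  "shear2 x = (\<Sum>j\<in>UNIV. sin (x $ Inl j) *\<^sub>R axis (Inr j) 1)"

text \<open>That an amplitude varies on a time scale \<open>O(\<nu>\<^sup>-\<^sup>1\<^sup>/\<^sup>2)\<close> means that its rate of change is at most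
  \<open>A \<nu>\<^sup>1\<^sup>/\<^sup>2\<close>; the constant \<open>A\<close> of the \<open>O\<close> is a parameter so that it can be chosen before \<open>\<nu>\<close>.\<close>

definition shear_amplitude :: "real \<Rightarrow> real \<Rightarrow> (real \<Rightarrow> real) \<Rightarrow> bool" where
  "shear_amplitude A \<nu> \<Phi> \<longleftrightarrow> smooth_on_halfline \<Phi> \<and> \<Phi> ` {0..} \<subseteq> {0..1} \<and>
     (A * sqrt \<nu>)-lipschitz_on {0..} \<Phi>"

definition alternating_sine_shear ::
  "real \<Rightarrow> real \<Rightarrow> (real \<Rightarrow> real^('n::finite + 'n) \<Rightarrow> real^('n + 'n)) \<Rightarrow> bool" where
  "alternating_sine_shear A \<nu> V \<longleftrightarrow> (\<exists>\<Phi>1 \<Phi>2. shear_amplitude A \<nu> \<Phi>1 \<and> shear_amplitude A \<nu> \<Phi>2 \<and>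
     (\<forall>t\<ge>0. \<forall>x. V t x = \<Phi>1 t *\<^sub>R shear1 x + \<Phi>2 t *\<^sub>R shear2 x))"

text \<open>The class in which the parabolic equations are solved: \<open>C\<^sup>1\<close> in time and \<open>C\<^sup>2\<close> in space at
  positive times, with the initial value in \<open>L\<^sup>2\<close> and attained in \<open>L\<^sup>2\<close>.  For the equations considered
  here, parabolic smoothing puts the solution with any \<open>L\<^sup>2\<close> initial value into this class.\<close>

definition parabolic_class :: "(real \<Rightarrow> real^'d \<Rightarrow> real) \<Rightarrow> bool" where
  "parabolic_class \<eta> \<longleftrightarrow>
     (\<forall>t\<ge>0. torus_periodic (\<eta> t)) \<and>
     (\<forall>t>0. C_diff 2 (\<eta> t)) \<and>
     (\<forall>t>0. \<forall>x. (\<lambda>s. \<eta> s x) differentiable (at t)) \<and>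
     continuous_on ({0<..} \<times> UNIV) (\<lambda>(t, x). \<eta> t x) \<and>
     continuous_on ({0<..} \<times> UNIV) (\<lambda>(t, x). deriv (\<lambda>s. \<eta> s x) t) \<and>
     (\<forall>i. continuous_on ({0<..} \<times> UNIV) (\<lambda>(t, x). pderivative i (\<eta> t) x)) \<and>
     (\<forall>i j. continuous_on ({0<..} \<times> UNIV) (\<lambda>(t, x). pderivative i (pderivative j (\<eta> t)) x)) \<and>
     torus_L2 (\<eta> 0) \<and>
     ((\<lambda>t. L2_norm (\<lambda>x. \<eta> t x - \<eta> 0 x)) \<longlongrightarrow> 0) (at_right 0)"

definition passive_scalar_solution ::
  "real \<Rightarrow> (real \<Rightarrow> real^'d \<Rightarrow> real^'d) \<Rightarrow> (real \<Rightarrow> real^'d \<Rightarrow> real) \<Rightarrow> bool" where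
  "passive_scalar_solution \<nu> V \<eta> \<longleftrightarrow> parabolic_class \<eta> \<and>
     (\<forall>t>0. \<forall>x. deriv (\<lambda>s. \<eta> s x) t + V t x \<bullet> grad (\<eta> t) x = \<nu> * laplacian (\<eta> t) x)"

definition enhanced_dissipation ::
  "real \<Rightarrow> (real \<Rightarrow> real^'d \<Rightarrow> real^'d) \<Rightarrow> real \<Rightarrow> real \<Rightarrow> bool" where
  "enhanced_dissipation \<nu> V C \<delta> \<longleftrightarrow> (\<forall>\<eta>. passive_scalar_solution \<nu> V \<eta> \<longrightarrow>
     (\<forall>s\<ge>0. \<forall>t\<ge>0. L2_norm (\<lambda>x. \<eta> (s + t) x - torus_mean (\<eta> (s + t)))
        \<le> C * L2_norm (\<lambda>x. \<eta> s x - torus_mean (\<eta> s)) * exp (- \<delta> * sqrt \<nu> * t)))"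

definition weighted_solution ::
  "real \<Rightarrow> (real \<Rightarrow> real^'d \<Rightarrow> real^'d) \<Rightarrow> (real^'d \<Rightarrow> real) \<Rightarrow> (real \<Rightarrow> real^'d \<Rightarrow> real) \<Rightarrow> bool" where
  "weighted_solution \<nu> V W \<omega> \<longleftrightarrow> parabolic_class \<omega> \<and>
     (\<forall>x. \<omega> 0 x = torus_volume TYPE('d)) \<and>
     (\<forall>t>0. \<forall>x. deriv (\<lambda>s. \<omega> s x) t + V t x \<bullet> grad (\<omega> t) x - \<omega> t x * (V t x \<bullet> grad W x)
        = \<nu> * exp (W x) * laplacian (\<lambda>y. \<omega> t y * exp (- W y)) x)"

end

theory Submission imports Defs begin

text \<open>With \<open>F = exp (- W)\<close>, the product \<open>\<eta> = \<omega> F\<close> solves the passive scalar equation, because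
  \<open>\<nabla>\<eta> = F (\<nabla>\<omega> - \<omega> \<nabla>W)\<close>.  Its mean is conserved: the flow is divergence-free, so on the torus all
  spatial terms integrate to zero, and the initial value is attained in \<open>L\<^sup>2\<close>.  Since \<open>\<eta> 0\<close> is the
  volume of the torus times \<open>F\<close>, that mean is \<open>M\<close>, and enhanced dissipation of \<open>\<eta>\<close> gives the claim
  with \<open>C = C_ED\<close>.\<close>

section \<open>Integration of periodic functions over a period cell\<close>

abbreviation torus_cell :: "(real^'d) set" where
  "torus_cell \<equiv> cbox 0 (\<chi> i. 2 * pi)"

lemma torus_periodicD: "torus_periodic f \<Longrightarrow> f (x + axis i (2 * pi)) = f x"
  by (simp add: torus_periodic_def)

lemma integrable_torus_continuous:
  fixes f :: "real^'d \<Rightarrow> real"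
  assumes "continuous_on UNIV f"
  shows "integrable torus_measure f"
  unfolding torus_measure_def
  by (intro continuous_imp_integrable continuous_on_subset[OF assms]) auto

lemma lebesgue_integral_torus_continuous:
  fixes f :: "real^'d \<Rightarrow> real"
  assumes "continuous_on UNIV f"
  shows "(\<integral>x. f x \<partial>torus_measure) = integral torus_cell f"
  using lebesgue_integral_eq_integral[OF integrable_torus_continuous[OF assms, unfolded torus_measure_def]]
  by (simp add: torus_measure_def)

lemma integrable_on_torus_cell:
  fixes f :: "real^'d \<Rightarrow> real"
  assumes "continuous_on UNIV f"
  shows "f integrable_on cbox a b"
  by (intro integrable_continuous continuous_on_subset[OF assms]) auto

text \<open>The translated cell is cut by the hyperplane where coordinate \<open>i\<close> equals
  \<open>2 * pi\<close>. The part beyond it, moved back by one period, is exactly the slab of the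
  original cell that the translation has left uncovered, and periodicity keeps its integral
  unchanged.\<close>

lemma integral_torus_cell_translate:
  fixes g :: "real^'d \<Rightarrow> real"
  assumes per: "torus_periodic g" and cont: "continuous_on UNIV g"
    and h: "0 \<le> h" "h \<le> 2 * pi"
  shows "integral torus_cell (\<lambda>x. g (x + axis i h)) = integral torus_cell g"
proof -
  let ?p = "\<chi> i. 2 * pi :: real^'d" and ?e = "axis i :: real \<Rightarrow> real^'d"
  have int: "g integrable_on cbox a b" for a b
    by (rule integrable_on_torus_cell[OF cont])
  have inn: "x \<bullet> axis i 1 = x $ i" for x :: "real^'d"
    by (simp add: inner_axis)
  \<comment> \<open>Cutting a box by a condition \<open>P\<close> on coordinate \<open>i\<close> is
    reduced to a condition on each coordinate separately, so that all four cuts below follow from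
    one rule.\<close>
  have halfspace: "cbox a b \<inter> {x. P (x \<bullet> axis i 1)} = cbox a' b'"
    if "\<And>j y. (a $ j \<le> y \<and> y \<le> b $ j) \<and> (j = i \<longrightarrow> P y) \<longleftrightarrow> a' $ j \<le> y \<and> y \<le> b' $ j"
    for a b a' b' :: "real^'d" and P
    unfolding set_eq_iff Int_iff mem_box_cart mem_Collect_eq inn that[symmetric] by metis
  \<comment> \<open>The corner \<open>?p + ?e h - ?e (2 * pi)\<close> is the upper corner of the
    cell with coordinate \<open>i\<close> lowered to \<open>h\<close>. The first and the last cut
    give the same box, the overlap of the cell with its translate.\<close>
  have split: "cbox (?e h) (?p + ?e h) \<inter> {x. x \<bullet> axis i 1 \<le> 2 * pi} = cbox (?e h) ?p"
    "cbox (?e h) (?p + ?e h) \<inter> {x. x \<bullet> axis i 1 \<ge> 2 * pi} = cbox (?e (2 * pi)) (?p + ?e h)"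
    "torus_cell \<inter> {x. x \<bullet> axis i 1 \<le> h} = cbox 0 (?p + ?e h - ?e (2 * pi))"
    "torus_cell \<inter> {x. x \<bullet> axis i 1 \<ge> h} = cbox (?e h) ?p"
    using h by (intro halfspace; auto simp: axis_def)+
  have shift: "integral (cbox a b) (\<lambda>x. g (x + c)) = integral (cbox (a + c) (b + c)) g" for a b c
    using integral_shift_cbox[of "a + c" c "b + c" g] by simp
  have "integral torus_cell (\<lambda>x. g (x + ?e h)) = integral (cbox (?e h) (?p + ?e h)) g"
    by (simp add: shift)
  also have "\<dots> = integral (cbox (?e h) ?p) g + integral (cbox (?e (2 * pi)) (?p + ?e h)) g"
    using integral_split[OF int, of "axis i 1" "?e h" "?p + ?e h" "2 * pi"]
    by (simp add: split axis_in_Basis_iff)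
  also have "integral (cbox (?e (2 * pi)) (?p + ?e h)) g
      = integral (cbox 0 (?p + ?e h - ?e (2 * pi))) (\<lambda>x. g (x + ?e (2 * pi)))"
    by (simp add: shift)
  also have "\<dots> = integral (cbox 0 (?p + ?e h - ?e (2 * pi))) g"
    by (simp add: torus_periodicD[OF per])
  also have "integral (cbox (?e h) ?p) g + \<dots> = integral torus_cell g"
    using integral_split[OF int, of "axis i 1" 0 ?p h]
    by (simp add: split axis_in_Basis_iff)
  finally show ?thesis .
qed

lemma axis_eq_scaleR: "axis i h = h *\<^sub>R (axis i 1 :: real^'d)"
  by (simp add: axis_def vec_eq_iff)

text \<open>The integrals of the translates of a periodic function do not depend on the translation, and
  differentiating them at the origin gives the integral of the derivative.\<close>

lemma integral_torus_cell_derivative_eq_0: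
  fixes g g' :: "real^'d \<Rightarrow> real"
  assumes per: "torus_periodic g" and cont: "continuous_on UNIV g" "continuous_on UNIV g'"
    and deriv: "\<And>x h. ((\<lambda>h. g (x + h *\<^sub>R axis i 1)) has_real_derivative g' (x + h *\<^sub>R axis i 1)) (at h)"
  shows "integral torus_cell g' = 0"
proof -
  \<comment> \<open>Translations are available for \<open>h\<close> in this interval only, so the
    derivative at 0 is one-sided. It is still unique, because the filter at 0 within the interval is
    nontrivial.\<close>
  let ?U = "{0..2 * pi}"
  have c: "continuous_on S (\<lambda>(h, x). g' (x + h *\<^sub>R axis i 1))" for S
    unfolding split_beta
    by (intro continuous_on_compose2[OF cont(2)] continuous_intros) auto
  have "((\<lambda>h. integral torus_cell (\<lambda>x. g (x + h *\<^sub>R axis i 1))) has_real_derivative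
      integral torus_cell (\<lambda>x. g' (x + 0 *\<^sub>R axis i 1))) (at 0 within ?U)"
    by (rule leibniz_rule_field_derivative[where fx = "\<lambda>h x. g' (x + h *\<^sub>R axis i 1)"])
      (auto intro!: c DERIV_subset[OF deriv] integrable_on_torus_cell continuous_on_compose2[OF cont(1)]
         continuous_intros)
  moreover have "((\<lambda>h. integral torus_cell (\<lambda>x. g (x + h *\<^sub>R axis i 1))) has_real_derivative 0) (at 0 within ?U)"
    unfolding has_field_derivative_def
    by (rule has_derivative_transform[where f = "\<lambda>_. integral torus_cell g"])
      (auto simp: integral_torus_cell_translate[OF per cont(1)] simp flip: axis_eq_scaleR lambda_zero)
  moreover have "at (0::real) within ?U \<noteq> bot"
    by (simp add: at_within_Icc_at_right)
  ultimately have "integral torus_cell (\<lambda>x. g' (x + 0 *\<^sub>R axis i 1)) = 0"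
    using has_field_derivative_unique by blast
  then show ?thesis by simp
qed

section \<open>Calculus of partial derivatives and of the classes \<open>C_diff k\<close>\<close>

lemma C_diff_continuous: "C_diff k f \<Longrightarrow> continuous_on UNIV f"
  by (cases k) (auto simp: differentiable_imp_continuous_on)

lemma C_diff_SucD: "C_diff (Suc k) f \<Longrightarrow> C_diff k f"
proof (induction k arbitrary: f)
  case 0
  then show ?case using C_diff_continuous by (metis C_diff.simps(1))
qed auto

lemma has_derivative_frechet:
  "f differentiable_on UNIV \<Longrightarrow> (f has_derivative frechet_derivative f (at x)) (at x)"
  by (simp add: differentiable_on_def frechet_derivative_works[symmetric])

lemma pderivative_eqI: "(f has_derivative f') (at x) \<Longrightarrow> pderivative i f x = f' (axis i 1)"
  by (simp add: pderivative_def frechet_derivative_at[symmetric])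

text \<open>This turns the Frechet-based partial derivative into a one-variable derivative along a
  line, the form in which the vanishing of integrals of derivatives is stated.\<close>

lemma has_real_derivative_pderivative:
  assumes "f differentiable_on UNIV"
  shows "((\<lambda>h. f (x + h *\<^sub>R axis i 1)) has_real_derivative pderivative i f (x + h *\<^sub>R axis i 1)) (at h)"
proof -
  note f' = has_derivative_frechet[OF assms, of "x + h *\<^sub>R axis i 1"]
  have "((\<lambda>h. x + h *\<^sub>R axis i 1) has_derivative (\<lambda>k. k *\<^sub>R axis i 1)) (at h)"
    by (auto intro!: derivative_eq_intros)
  from has_derivative_compose[OF this f'] show ?thesis
    using has_derivative_linear[OF f']
    by (simp add: has_field_derivative_def pderivative_def linear_cmul mult_commute_abs)
qed

text \<open>An equality of functions rather than of values, so that it also rewrites inside another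
  \<open>pderivative\<close>; the product rule below has the same form.\<close>

lemma pderivative_add:
  assumes "f differentiable_on UNIV" "g differentiable_on UNIV"
  shows "pderivative i (\<lambda>x. f x + g x) = (\<lambda>x. pderivative i f x + pderivative i g x)"
proof
  fix x
  show "pderivative i (\<lambda>x. f x + g x) x = pderivative i f x + pderivative i g x"
    by (subst pderivative_eqI)
      (rule has_derivative_add has_derivative_frechet assms refl | simp add: pderivative_def)+
qed

lemma pderivative_mult:
  assumes "f differentiable_on UNIV" "g differentiable_on UNIV"
  shows "pderivative i (\<lambda>x. f x * g x) = (\<lambda>x. f x * pderivative i g x + pderivative i f x * g x)"
proof
  fix x
  show "pderivative i (\<lambda>x. f x * g x) x = f x * pderivative i g x + pderivative i f x * g x"
    by (subst pderivative_eqI)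
      (rule has_derivative_mult has_derivative_frechet assms refl | simp add: pderivative_def)+
qed

lemma C_diff_add:
  "C_diff k f \<Longrightarrow> C_diff k g \<Longrightarrow> C_diff k (\<lambda>x. f x + g x)"
  by (induction k arbitrary: f g) (auto simp: pderivative_add intro!: continuous_intros)

lemma C_diff_mult:
  "C_diff k f \<Longrightarrow> C_diff k g \<Longrightarrow> C_diff k (\<lambda>x. f x * g x)"
proof (induction k arbitrary: f g)
  case 0
  then show ?case by (auto intro!: continuous_intros)
next
  case (Suc k)
  \<comment> \<open>The product rule pairs each undifferentiated factor with a derivative that is
    only of class \<open>k\<close>, so the induction hypothesis needs the factors themselves at
    order \<open>k\<close>.\<close>
  then have "C_diff k f" "C_diff k g" by (auto intro: C_diff_SucD)
  with Suc show ?case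
    by (auto simp: pderivative_mult intro!: C_diff_add)
qed

lemma torus_periodic_mult:
  "torus_periodic f \<Longrightarrow> torus_periodic g \<Longrightarrow> torus_periodic (\<lambda>x. f x * g x)"
  by (simp add: torus_periodic_def)

text \<open>By the chain rule for a translation by one period, the derivative of \<open>f\<close> at
  the shifted point is also a derivative of \<open>f\<close> at \<open>x\<close>, and derivatives
  are unique.\<close>

lemma torus_periodic_pderivative:
  fixes f :: "real^'d \<Rightarrow> real"
  assumes "torus_periodic f" "f differentiable_on UNIV"
  shows "torus_periodic (pderivative i f)"
  unfolding torus_periodic_def
proof (intro allI)
  fix x :: "real^'d" and j
  let ?y = "x + axis j (2 * pi)"
  have "((\<lambda>z. z + axis j (2 * pi)) has_derivative (\<lambda>z. z)) (at x)"
    by (auto intro!: derivative_eq_intros)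
  from has_derivative_compose[OF this has_derivative_frechet[OF assms(2)]]
  have "(f has_derivative frechet_derivative f (at ?y)) (at x)"
    by (simp add: torus_periodicD[OF assms(1)])
  from pderivative_eqI[OF this, of i] show "pderivative i f ?y = pderivative i f x"
    by (simp add: pderivative_def)
qed

section \<open>Square-integrable functions and means on the torus\<close>

lemma finite_measure_torus: "finite_measure torus_measure"
  unfolding torus_measure_def by (intro finite_measure_lebesgue_on) simp

lemma measure_torus:
  "measure (torus_measure :: (real^'d) measure) (space torus_measure) = torus_volume TYPE('d)"
proof -
  have "(torus_cell :: (real^'d) set) \<noteq> {}"
    by (auto simp: interval_ne_empty_cart)
  from content_cbox_cart[OF this] show ?thesis
    by (simp add: torus_measure_def torus_volume_def measure_restrict_space)
qed

lemma torus_volume_pos: "torus_volume TYPE('d::finite) > 0"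
  by (simp add: torus_volume_def)

lemma torus_L2_continuous: "continuous_on UNIV f \<Longrightarrow> torus_L2 f"
  unfolding torus_L2_def
  by (intro conjI borel_measurable_integrable integrable_torus_continuous continuous_intros)

lemma torus_L2_integrable: "torus_L2 f \<Longrightarrow> integrable torus_measure f"
  unfolding torus_L2_def
  by (blast intro: finite_measure.square_integrable_imp_integrable[OF finite_measure_torus])

lemma torus_L2_diff:
  assumes "torus_L2 f" "torus_L2 g"
  shows "torus_L2 (\<lambda>x. f x - g x)"
  unfolding torus_L2_def
proof
  note [measurable] = assms[unfolded torus_L2_def, THEN conjunct1]
  show "(\<lambda>x. f x - g x) \<in> borel_measurable torus_measure" by measurable
  have "(f x - g x)\<^sup>2 \<le> 2 * (f x)\<^sup>2 + 2 * (g x)\<^sup>2" for x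
    using zero_le_power2[of "f x + g x"] by (simp add: power2_eq_square algebra_simps)
  then have le: "norm ((f x - g x)\<^sup>2) \<le> norm (2 * (f x)\<^sup>2 + 2 * (g x)\<^sup>2)" for x
    using abs_ge_self order_trans by fastforce
  have "integrable torus_measure (\<lambda>x. 2 * (f x)\<^sup>2 + 2 * (g x)\<^sup>2)"
    using assms by (simp add: torus_L2_def)
  then show "integrable torus_measure (\<lambda>x. (f x - g x)\<^sup>2)"
    by (rule Bochner_Integration.integrable_bound[OF _ _ AE_I2[OF le]]) measurable
qed

text \<open>Multiplication by a function bounded on the cell is a bounded operator on L2. This
  carries the L2 attainment of the initial value from \<omega> to its product with
  \<open>F\<close>.\<close>

lemma
  assumes f: "torus_L2 f" and g: "g \<in> borel_measurable torus_measure"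
    and bound: "\<And>x. x \<in> torus_cell \<Longrightarrow> \<bar>g x\<bar> \<le> B"
  shows torus_L2_mult_bounded: "torus_L2 (\<lambda>x. f x * g x)" (is ?L2)
    and L2_norm_mult_bounded: "L2_norm (\<lambda>x. f x * g x) \<le> B * L2_norm f" (is ?norm)
proof -
  note [measurable] = f[unfolded torus_L2_def, THEN conjunct1] g
  have sp: "space torus_measure = torus_cell"
    by (simp add: torus_measure_def)
  have int: "integrable torus_measure (\<lambda>x. (f x)\<^sup>2)"
    using f by (simp add: torus_L2_def)
  have le: "(f x * g x)\<^sup>2 \<le> B\<^sup>2 * (f x)\<^sup>2" if "x \<in> torus_cell" for x
    using mult_right_mono[OF power_mono[OF bound[OF that] abs_ge_zero, of 2], of "(f x)\<^sup>2"]
    by (simp add: power_mult_distrib mult.commute)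
  have "integrable torus_measure (\<lambda>x. B\<^sup>2 * (f x)\<^sup>2)"
    using int by simp
  then have int': "integrable torus_measure (\<lambda>x. (f x * g x)\<^sup>2)"
    by (rule Bochner_Integration.integrable_bound[OF _ _ AE_I2]) (use le in \<open>simp_all add: sp\<close>)
  then show ?L2 by (simp add: torus_L2_def)
  \<comment> \<open>The cell is nonempty, so the bound forces \<open>B \<ge> 0\<close>, and the
    square root of \<open>B\<^sup>2\<close> is \<open>B\<close>.\<close>
  have "0 \<in> (torus_cell :: (real^'a) set)" by (simp add: mem_box_cart)
  then have "B \<ge> 0" using bound abs_ge_zero order_trans by blast
  have "(\<integral>x. (f x * g x)\<^sup>2 \<partial>torus_measure) \<le> (\<integral>x. B\<^sup>2 * (f x)\<^sup>2 \<partial>torus_measure)"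
    by (rule integral_mono) (auto simp: int int' sp le)
  then have "L2_norm (\<lambda>x. f x * g x) \<le> sqrt (B\<^sup>2 * (\<integral>x. (f x)\<^sup>2 \<partial>torus_measure))"
    unfolding L2_norm_def by simp
  then show ?norm
    using \<open>B \<ge> 0\<close> by (simp add: L2_norm_def real_sqrt_mult)
qed

text \<open>The integral of the squared deviation from the mean is nonnegative, and expanding it
  gives the bound. The estimate makes the mean continuous with respect to L2 convergence.\<close>

lemma abs_torus_mean_le:
  fixes f :: "real^'d \<Rightarrow> real"
  assumes "torus_L2 f"
  shows "\<bar>torus_mean f\<bar> \<le> L2_norm f / sqrt (torus_volume TYPE('d))"
proof -
  let ?v = "torus_volume TYPE('d)" and ?m = "torus_mean f"
  interpret finite_measure "torus_measure :: (real^'d) measure" by (rule finite_measure_torus)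
  have int: "integrable torus_measure f" "integrable torus_measure (\<lambda>x. (f x)\<^sup>2)"
    using assms torus_L2_integrable by (auto simp: torus_L2_def)
  have m: "(\<integral>x. f x \<partial>torus_measure) = ?v * ?m"
    using torus_volume_pos[where 'd='d] by (simp add: torus_mean_def)
  have "0 \<le> (\<integral>x. (f x - ?m)\<^sup>2 \<partial>torus_measure)" by simp
  also have "\<dots> = (\<integral>x. (f x)\<^sup>2 - 2 * ?m * f x + ?m\<^sup>2 \<partial>torus_measure)"
    by (intro Bochner_Integration.integral_cong) (auto simp: power2_diff)
  also have "\<dots> = (\<integral>x. (f x)\<^sup>2 \<partial>torus_measure) - ?v * ?m\<^sup>2"
    using int by (simp add: m measure_torus power2_eq_square)
  finally have "?m\<^sup>2 \<le> (\<integral>x. (f x)\<^sup>2 \<partial>torus_measure) / ?v"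
    using torus_volume_pos[where 'd='d] by (simp add: field_simps)
  then have "sqrt (?m\<^sup>2) \<le> sqrt ((\<integral>x. (f x)\<^sup>2 \<partial>torus_measure) / ?v)"
    by (rule real_sqrt_le_mono)
  then show ?thesis by (simp add: L2_norm_def real_sqrt_divide)
qed

section \<open>From the weighted equation to the passive scalar equation\<close>

lemma continuous_on_snd_compose:
  "continuous_on UNIV f \<Longrightarrow> continuous_on S (\<lambda>p. f (snd p))"
  by (rule continuous_on_compose2[where g = f]) (auto intro: continuous_intros)

lemma parabolic_class_deriv_mult:
  assumes "parabolic_class \<omega>" "t > 0"
  shows "deriv (\<lambda>s. \<omega> s x * c) t = deriv (\<lambda>s. \<omega> s x) t * c"
proof (rule DERIV_imp_deriv)
  have "(\<lambda>s. \<omega> s x) differentiable (at t)"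
    using assms by (simp add: parabolic_class_def)
  then have "((\<lambda>s. \<omega> s x) has_real_derivative deriv (\<lambda>s. \<omega> s x) t) (at t)"
    by (simp add: DERIV_deriv_iff_real_differentiable)
  then show "((\<lambda>s. \<omega> s x * c) has_real_derivative deriv (\<lambda>s. \<omega> s x) t * c) (at t)"
    by (rule DERIV_cmult_right)
qed

text \<open>The regularity clauses follow from the product rule at positive times. The initial value
  is attained because \<open>F\<close> is continuous, hence bounded on the compact cell.\<close>

lemma parabolic_class_mult:
  fixes \<omega> :: "real \<Rightarrow> real^'d \<Rightarrow> real"
  assumes \<omega>: "parabolic_class \<omega>" and F: "torus_periodic F" "C_diff 2 F"
  shows "parabolic_class (\<lambda>t x. \<omega> t x * F x)"
proof -
  have C2: "C_diff (Suc (Suc 0)) (\<omega> t)" if "t > 0" for t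
    using \<omega> that by (simp add: parabolic_class_def numeral_2_eq_2)
  have F2: "C_diff (Suc (Suc 0)) F" using F by (simp add: numeral_2_eq_2)
  have F_cont: "continuous_on UNIV F" "\<And>i. continuous_on UNIV (pderivative i F)"
    "\<And>i j. continuous_on UNIV (pderivative i (pderivative j F))"
    and F_diff: "F differentiable_on UNIV" "\<And>i. pderivative i F differentiable_on UNIV"
    using F2 C_diff_continuous[OF F2] by (auto intro: differentiable_imp_continuous_on)
  have \<omega>_diff: "\<omega> t differentiable_on UNIV" "\<And>i. pderivative i (\<omega> t) differentiable_on UNIV"
    if "t > 0" for t
    using C2[OF that] by auto
  note deriv = parabolic_class_deriv_mult[OF \<omega>]
  have pd: "pderivative i (\<lambda>x. \<omega> t x * F x)
      = (\<lambda>x. \<omega> t x * pderivative i F x + pderivative i (\<omega> t) x * F x)" if "t > 0" for t i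
    using that by (simp add: pderivative_mult \<omega>_diff F_diff)
  have pd2: "pderivative i (pderivative j (\<lambda>x. \<omega> t x * F x))
      = (\<lambda>x. \<omega> t x * pderivative i (pderivative j F) x + pderivative i (\<omega> t) x * pderivative j F x
          + (pderivative j (\<omega> t) x * pderivative i F x + pderivative i (pderivative j (\<omega> t)) x * F x))"
    if "t > 0" for t i j
    using that by (simp add: pd pderivative_add pderivative_mult \<omega>_diff F_diff differentiable_on_mult)
  \<comment> \<open>Projections replace the pair patterns of \<open>parabolic_class\<close>, so that
    the continuity rules can be applied to composite expressions.\<close>
  have joint: "continuous_on ({0<..} \<times> UNIV) (\<lambda>p. \<omega> (fst p) (snd p))"
    "continuous_on ({0<..} \<times> UNIV) (\<lambda>p. deriv (\<lambda>s. \<omega> s (snd p)) (fst p))"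
    "continuous_on ({0<..} \<times> UNIV) (\<lambda>p. pderivative i (\<omega> (fst p)) (snd p))"
    "continuous_on ({0<..} \<times> UNIV) (\<lambda>p. pderivative i (pderivative j (\<omega> (fst p))) (snd p))" for i j
    using \<omega> by (simp_all add: parabolic_class_def split_beta)
  note cont_intros = continuous_intros joint F_cont[THEN continuous_on_snd_compose]
  obtain B where B: "\<And>x. x \<in> torus_cell \<Longrightarrow> \<bar>F x\<bar> \<le> B"
    using compact_imp_bounded[OF compact_continuous_image[OF continuous_on_subset[OF F_cont(1) subset_UNIV]
      compact_cbox]] unfolding bounded_iff by (metis image_eqI real_norm_def)
  have F_meas: "F \<in> borel_measurable torus_measure"
    by (intro borel_measurable_integrable integrable_torus_continuous F_cont)
  have \<omega>0: "torus_L2 (\<omega> 0)" using \<omega> by (simp add: parabolic_class_def)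
  have "((\<lambda>t. L2_norm (\<lambda>x. \<omega> t x * F x - \<omega> 0 x * F x)) \<longlongrightarrow> 0) (at_right 0)"
  proof (rule tendsto_sandwich[where f = "\<lambda>_. 0"
        and h = "\<lambda>t. B * L2_norm (\<lambda>x. \<omega> t x - \<omega> 0 x)"])
    have "((\<lambda>t. L2_norm (\<lambda>x. \<omega> t x - \<omega> 0 x)) \<longlongrightarrow> 0) (at_right 0)"
      using \<omega> by (simp add: parabolic_class_def)
    then show "((\<lambda>t. B * L2_norm (\<lambda>x. \<omega> t x - \<omega> 0 x)) \<longlongrightarrow> 0) (at_right 0)"
      by (rule tendsto_mult_right_zero)
    show "\<forall>\<^sub>F t in at_right 0. L2_norm (\<lambda>x. \<omega> t x * F x - \<omega> 0 x * F x) \<le> B * L2_norm (\<lambda>x. \<omega> t x - \<omega> 0 x)"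
      using eventually_at_right_less[of 0]
    proof eventually_elim
      case (elim t)
      then have "torus_L2 (\<lambda>x. \<omega> t x - \<omega> 0 x)"
        by (intro torus_L2_diff torus_L2_continuous \<omega>0 C_diff_continuous[OF C2])
      from L2_norm_mult_bounded[OF this F_meas B] show ?case
        by (simp add: left_diff_distrib)
    qed
  qed (auto simp: L2_norm_def)
  moreover have "torus_L2 (\<lambda>x. \<omega> 0 x * F x)"
    by (rule torus_L2_mult_bounded[OF \<omega>0 F_meas B])
  moreover have "torus_periodic (\<lambda>x. \<omega> t x * F x)" if "t \<ge> 0" for t
    using \<omega> that F by (simp add: parabolic_class_def torus_periodic_mult)
  moreover have "C_diff 2 (\<lambda>x. \<omega> t x * F x)" if "t > 0" for t
    using C2[OF that] F by (intro C_diff_mult) (simp_all add: numeral_2_eq_2)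
  moreover have "(\<lambda>s. \<omega> s x * F x) differentiable (at t)" if "t > 0" for t x
    using \<omega> that by (intro differentiable_mult) (simp_all add: parabolic_class_def)
  moreover have "continuous_on ({0<..} \<times> UNIV) (\<lambda>(t, x). \<omega> t x * F x)"
    unfolding split_beta by (intro cont_intros)
  \<comment> \<open>The formulas for the derivatives of the product hold at positive times, so for
    this clause and the next two they are substituted on the set \<open>{0<..} \<times> UNIV\<close>
    and not as equalities for all times.\<close>
  moreover have "continuous_on ({0<..} \<times> UNIV) (\<lambda>(t, x). deriv (\<lambda>s. \<omega> s x * F x) t)"
    by (rule continuous_on_eq[where f = "\<lambda>p. deriv (\<lambda>s. \<omega> s (snd p)) (fst p) * F (snd p)"])
      (auto simp: deriv intro!: cont_intros)
  moreover have "continuous_on ({0<..} \<times> UNIV) (\<lambda>(t, x). pderivative i (\<lambda>x. \<omega> t x * F x) x)" for i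
    by (rule continuous_on_eq[where f = "\<lambda>p. \<omega> (fst p) (snd p) * pderivative i F (snd p)
          + pderivative i (\<omega> (fst p)) (snd p) * F (snd p)"])
      (auto simp: pd intro!: cont_intros)
  moreover have "continuous_on ({0<..} \<times> UNIV)
      (\<lambda>(t, x). pderivative i (pderivative j (\<lambda>x. \<omega> t x * F x)) x)" for i j
    by (rule continuous_on_eq[where f = "\<lambda>p. \<omega> (fst p) (snd p) * pderivative i (pderivative j F) (snd p)
          + pderivative i (\<omega> (fst p)) (snd p) * pderivative j F (snd p)
          + (pderivative j (\<omega> (fst p)) (snd p) * pderivative i F (snd p)
          + pderivative i (pderivative j (\<omega> (fst p))) (snd p) * F (snd p))"])
      (auto simp: pd2 intro!: cont_intros)
  ultimately show ?thesis by (simp add: parabolic_class_def)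
qed

text \<open>Multiplying the equation by \<open>exp (- W x)\<close> turns its left side into the
  transport of the product and cancels the factor \<open>exp (W x)\<close> on the right, where the
  Laplacian already acts on the product.\<close>

lemma weighted_solution_imp_passive_scalar:
  fixes W :: "real^'d \<Rightarrow> real"
  assumes \<omega>: "weighted_solution \<nu> V W \<omega>"
    and F: "torus_periodic (\<lambda>x. exp (- W x))" "C_diff 2 (\<lambda>x. exp (- W x))"
  shows "passive_scalar_solution \<nu> V (\<lambda>t x. \<omega> t x * exp (- W x))"
  unfolding passive_scalar_solution_def
proof (intro conjI allI impI)
  let ?F = "\<lambda>x. exp (- W x)"
  have cls: "parabolic_class \<omega>" using \<omega> by (simp add: weighted_solution_def)
  then show "parabolic_class (\<lambda>t x. \<omega> t x * ?F x)"
    using F by (rule parabolic_class_mult)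
  fix t :: real and x :: "real^'d" assume "t > 0"
  have F_diff: "?F differentiable_on UNIV" and \<omega>_diff: "\<omega> t differentiable_on UNIV"
    using F cls \<open>t > 0\<close> by (auto simp: numeral_2_eq_2 parabolic_class_def)
  \<comment> \<open>The hypotheses give regularity of \<open>exp (- W x)\<close> only, so the
    derivative of \<open>W\<close> is recovered by writing \<open>W\<close> as minus its
    logarithm.\<close>
  have "((\<lambda>x. - ln (?F x)) has_derivative (\<lambda>h. - (frechet_derivative ?F (at x) h * inverse (?F x)))) (at x)"
    by (intro has_derivative_minus has_derivative_ln has_derivative_frechet[OF F_diff]) simp
  then have "(W has_derivative (\<lambda>h. - (frechet_derivative ?F (at x) h / ?F x))) (at x)"
    by (simp only: ln_exp minus_minus divide_inverse)
  from pderivative_eqI[OF this] have "pderivative i W x = - (pderivative i ?F x / ?F x)" for i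
    unfolding pderivative_def[of _ ?F] .
  then have "pderivative i ?F x = - (?F x * pderivative i W x)" for i
    by simp
  then have "grad (\<lambda>x. \<omega> t x * ?F x) x = ?F x *\<^sub>R (grad (\<omega> t) x - \<omega> t x *\<^sub>R grad W x)"
    by (simp add: grad_def vec_eq_iff pderivative_mult \<omega>_diff F_diff algebra_simps)
  moreover have "deriv (\<lambda>s. \<omega> s x * ?F x) t = ?F x * deriv (\<lambda>s. \<omega> s x) t"
    by (simp only: parabolic_class_deriv_mult[OF cls \<open>t > 0\<close>] mult.commute)
  ultimately have "deriv (\<lambda>s. \<omega> s x * ?F x) t + V t x \<bullet> grad (\<lambda>x. \<omega> t x * ?F x) x
      = ?F x * (deriv (\<lambda>s. \<omega> s x) t + V t x \<bullet> grad (\<omega> t) x - \<omega> t x * (V t x \<bullet> grad W x))"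
    by (simp only: inner_scaleR_right inner_diff_right) (simp only: algebra_simps)
  also have "\<dots> = ?F x * (\<nu> * exp (W x) * laplacian (\<lambda>y. \<omega> t y * ?F y) x)"
    using \<omega> \<open>t > 0\<close> by (simp add: weighted_solution_def)
  also have "\<dots> = \<nu> * laplacian (\<lambda>y. \<omega> t y * ?F y) x"
    by (simp add: exp_minus)
  finally show "deriv (\<lambda>s. \<omega> s x * ?F x) t + V t x \<bullet> grad (\<lambda>x. \<omega> t x * ?F x) x
    = \<nu> * laplacian (\<lambda>y. \<omega> t y * ?F y) x" .
qed

section \<open>Conservation of the mean\<close>

lemma inner_shear1: "shear1 x \<bullet> v = (\<Sum>j\<in>UNIV. sin (x $ Inr j) * v $ Inl j)"
  by (simp add: shear1_def inner_sum_left inner_axis')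

lemma inner_shear2: "shear2 x \<bullet> v = (\<Sum>j\<in>UNIV. sin (x $ Inl j) * v $ Inr j)"
  by (simp add: shear2_def inner_sum_left inner_axis')

text \<open>The \<open>has_integral\<close> form carries integrability along with the value, so the
  terms of the equation can later be combined by linearity alone.\<close>

lemma has_integral_torus_pderivative:
  assumes "torus_periodic f" "f differentiable_on UNIV" "continuous_on UNIV (pderivative i f)"
  shows "(pderivative i f has_integral 0) torus_cell"
  using integral_torus_cell_derivative_eq_0[OF assms(1) differentiable_imp_continuous_on[OF assms(2)]
      assms(3) has_real_derivative_pderivative[OF assms(2)]]
    integrable_integral[OF integrable_on_torus_cell[OF assms(3)]]
  by metis

text \<open>Since \<open>k \<noteq> i\<close>, the factor \<open>sin (x $ k)\<close> is constant in
  direction \<open>i\<close>, so the integrand is itself the derivative in that direction of a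
  periodic function. This is how the absence of divergence enters.\<close>

lemma has_integral_torus_shear:
  fixes f :: "real^'d \<Rightarrow> real"
  assumes f: "torus_periodic f" "f differentiable_on UNIV" "continuous_on UNIV (pderivative i f)"
    and "k \<noteq> i"
  shows "((\<lambda>x. sin (x $ k) * pderivative i f x) has_integral 0) torus_cell"
proof -
  have c: "continuous_on UNIV (\<lambda>x. sin (x $ k) * pderivative i f x)"
    by (intro continuous_intros f)
  have "integral torus_cell (\<lambda>x. sin (x $ k) * pderivative i f x) = 0"
  proof (rule integral_torus_cell_derivative_eq_0[where i = i, OF _ _ c])
    show "torus_periodic (\<lambda>x. sin (x $ k) * f x)"
      using f(1) by (auto simp: torus_periodic_def axis_def)
    show "continuous_on UNIV (\<lambda>x. sin (x $ k) * f x)"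
      by (intro continuous_intros differentiable_imp_continuous_on f)
    fix x :: "real^'d" and h
    have "(x + h *\<^sub>R axis i 1) $ k = x $ k" for h
      using \<open>k \<noteq> i\<close> by (simp add: axis_def)
    then show "((\<lambda>h. sin ((x + h *\<^sub>R axis i 1) $ k) * f (x + h *\<^sub>R axis i 1)) has_real_derivative
        sin ((x + h *\<^sub>R axis i 1) $ k) * pderivative i f (x + h *\<^sub>R axis i 1)) (at h)"
      by (simp only:) (intro DERIV_cmult has_real_derivative_pderivative f)
  qed
  with integrable_integral[OF integrable_on_torus_cell[OF c]] show ?thesis
    by metis
qed

text \<open>At positive times the mean is differentiated under the integral sign, and the equation
  makes the derivative vanish. Time 0 is reached by a limit, because there the class provides only
  convergence in L2.\<close>

lemma torus_mean_passive_scalar: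
  fixes V :: "real \<Rightarrow> real^('n::finite + 'n) \<Rightarrow> real^('n + 'n)"
  assumes V: "alternating_sine_shear A \<nu> V" and \<eta>: "passive_scalar_solution \<nu> V \<eta>" and "t \<ge> 0"
  shows "torus_mean (\<eta> t) = torus_mean (\<eta> 0)"
proof -
  let ?v = "torus_volume TYPE('n + 'n)"
  have cls: "parabolic_class \<eta>" using \<eta> by (simp add: passive_scalar_solution_def)
  obtain \<Phi>1 \<Phi>2 where V_eq: "V t x = \<Phi>1 t *\<^sub>R shear1 x + \<Phi>2 t *\<^sub>R shear2 x" if "t \<ge> 0" for t x
    using V unfolding alternating_sine_shear_def by blast
  have cont: "continuous_on UNIV (\<eta> t)" if "t > 0" for t
    using cls that by (intro C_diff_continuous[of 2]) (simp add: parabolic_class_def)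
  have mean_eq: "torus_mean (\<eta> t) = integral torus_cell (\<eta> t) / ?v" if "t > 0" for t
    by (simp add: torus_mean_def lebesgue_integral_torus_continuous[OF cont[OF that]])
  have zero: "((\<lambda>x. deriv (\<lambda>s. \<eta> s x) t) has_integral 0) torus_cell" if "t > 0" for t
  proof -
    have per: "torus_periodic (\<eta> t)" and C2: "C_diff (Suc (Suc 0)) (\<eta> t)"
      using cls that by (auto simp: parabolic_class_def numeral_2_eq_2)
    have diff: "\<eta> t differentiable_on UNIV" "\<And>i. pderivative i (\<eta> t) differentiable_on UNIV"
      and c: "\<And>i. continuous_on UNIV (pderivative i (\<eta> t))"
        "\<And>i j. continuous_on UNIV (pderivative i (pderivative j (\<eta> t)))"
      using C2 by (auto intro: differentiable_imp_continuous_on)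
    have eq: "deriv (\<lambda>s. \<eta> s x) t = \<nu> * laplacian (\<eta> t) x
        - (\<Phi>1 t * (\<Sum>j\<in>UNIV. sin (x $ Inr j) * pderivative (Inl j) (\<eta> t) x)
         + \<Phi>2 t * (\<Sum>j\<in>UNIV. sin (x $ Inl j) * pderivative (Inr j) (\<eta> t) x))" for x
    proof -
      have "deriv (\<lambda>s. \<eta> s x) t = \<nu> * laplacian (\<eta> t) x - V t x \<bullet> grad (\<eta> t) x"
        using \<eta> that by (simp add: passive_scalar_solution_def eq_diff_eq)
      then show ?thesis
        using that by (simp add: V_eq inner_add_left inner_shear1 inner_shear2 grad_def)
    qed
    have "((\<lambda>x. pderivative i (pderivative i (\<eta> t)) x) has_integral 0) torus_cell" for i
      by (rule has_integral_torus_pderivative[OF torus_periodic_pderivative[OF per diff(1)] diff(2) c(2)])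
    \<comment> \<open>The values stay unevaluated sums of zeros, as the rule for finite sums yields
      them, until the whole equation has been integrated.\<close>
    then have lap: "((\<lambda>x. laplacian (\<eta> t) x) has_integral (\<Sum>i\<in>(UNIV :: ('n + 'n) set). 0)) torus_cell"
      unfolding laplacian_def by (rule has_integral_sum[OF finite])
    have shear_j: "((\<lambda>x. sin (x $ Inr j) * pderivative (Inl j) (\<eta> t) x) has_integral 0) torus_cell"
      "((\<lambda>x. sin (x $ Inl j) * pderivative (Inr j) (\<eta> t) x) has_integral 0) torus_cell" for j
      by (rule has_integral_torus_shear[OF per diff(1) c(1)], simp)+
    have shear: "((\<lambda>x. \<Sum>j\<in>UNIV. sin (x $ Inr j) * pderivative (Inl j) (\<eta> t) x)
        has_integral (\<Sum>j\<in>(UNIV :: 'n set). 0)) torus_cell"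
      "((\<lambda>x. \<Sum>j\<in>UNIV. sin (x $ Inl j) * pderivative (Inr j) (\<eta> t) x)
        has_integral (\<Sum>j\<in>(UNIV :: 'n set). 0)) torus_cell"
      by (rule has_integral_sum[OF finite shear_j(1)], rule has_integral_sum[OF finite shear_j(2)])
    have "((\<lambda>x. deriv (\<lambda>s. \<eta> s x) t) has_integral
        \<nu> * (\<Sum>i\<in>(UNIV :: ('n + 'n) set). 0)
        - (\<Phi>1 t * (\<Sum>j\<in>(UNIV :: 'n set). 0) + \<Phi>2 t * (\<Sum>j\<in>(UNIV :: 'n set). 0))) torus_cell"
      unfolding eq by (rule has_integral_diff has_integral_add has_integral_mult_right lap shear)+
    then show ?thesis by simp
  qed
  have "((\<lambda>t. integral torus_cell (\<eta> t)) has_real_derivative 0) (at t within {0<..})" if "t \<in> {0<..}" for t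
  proof -
    have "((\<lambda>t. integral torus_cell (\<eta> t)) has_real_derivative
        integral torus_cell (\<lambda>x. deriv (\<lambda>s. \<eta> s x) t)) (at t within {0<..})"
    proof (rule leibniz_rule_field_derivative[where fx = "\<lambda>t x. deriv (\<lambda>s. \<eta> s x) t"])
      show "continuous_on ({0<..} \<times> torus_cell) (\<lambda>(t, x). deriv (\<lambda>s. \<eta> s x) t)"
        using cls by (auto simp: parabolic_class_def intro: continuous_on_subset)
      fix s :: real and x assume "s \<in> {0<..}"
      then have "(\<lambda>s. \<eta> s x) differentiable (at s)"
        using cls by (simp add: parabolic_class_def)
      then show "((\<lambda>s. \<eta> s x) has_real_derivative deriv (\<lambda>s. \<eta> s x) s) (at s within {0<..})"
        by (simp add: DERIV_deriv_iff_real_differentiable has_field_derivative_at_within)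
    qed (use that cont in \<open>auto intro: integrable_on_torus_cell\<close>)
    then show ?thesis using integral_unique[OF zero[of t]] that by simp
  qed
  from has_field_derivative_zero_constant[OF convex_real_interval(3) this]
  obtain c where "integral torus_cell (\<eta> t) = c" if "t > 0" for t
    by auto
  then have const: "torus_mean (\<eta> t) = c / ?v" if "t > 0" for t
    using mean_eq that by simp
  \<comment> \<open>The difference of the means is the mean of the difference, which its L2 norm
    controls with the factor \<open>1 / sqrt ?v\<close>.\<close>
  have "((\<lambda>t. torus_mean (\<eta> t) - torus_mean (\<eta> 0)) \<longlongrightarrow> 0) (at_right 0)"
  proof (rule tendsto_0_le[where K = "1 / sqrt ?v"])
    show "((\<lambda>t. L2_norm (\<lambda>x. \<eta> t x - \<eta> 0 x)) \<longlongrightarrow> 0) (at_right 0)"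
      using cls by (simp add: parabolic_class_def)
    show "\<forall>\<^sub>F t in at_right 0. norm (torus_mean (\<eta> t) - torus_mean (\<eta> 0))
        \<le> norm (L2_norm (\<lambda>x. \<eta> t x - \<eta> 0 x)) * (1 / sqrt ?v)"
      using eventually_at_right_less[of 0]
    proof eventually_elim
      case (elim t)
      have L2: "torus_L2 (\<eta> t)" "torus_L2 (\<eta> 0)"
        using elim cls by (auto simp: parabolic_class_def intro: torus_L2_continuous cont)
      then have "torus_mean (\<eta> t) - torus_mean (\<eta> 0) = torus_mean (\<lambda>x. \<eta> t x - \<eta> 0 x)"
        by (simp add: torus_mean_def torus_L2_integrable diff_divide_distrib)
      then show ?case
        using abs_torus_mean_le[OF torus_L2_diff[OF L2]] by (simp add: L2_norm_def)
    qed
  qed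
  \<comment> \<open>The same expression is constant for positive \<open>t\<close>; uniqueness of
    limits identifies that constant with 0.\<close>
  moreover have "((\<lambda>t. torus_mean (\<eta> t) - torus_mean (\<eta> 0)) \<longlongrightarrow> c / ?v - torus_mean (\<eta> 0)) (at_right 0)"
    by (rule tendsto_eventually)
      (use eventually_at_right_less[of 0] in \<open>eventually_elim, simp add: const\<close>)
  ultimately have "c / ?v - torus_mean (\<eta> 0) = 0"
    by (intro tendsto_unique[OF trivial_limit_at_right_real])
  then have "c / ?v = torus_mean (\<eta> 0)" by simp
  with const \<open>t \<ge> 0\<close> show ?thesis by (cases "t = 0") auto
qed

section \<open>Decay of the weighted solution\<close>

theorem theorem1p4:
  fixes A C_ED \<delta>_ED :: real
  assumes "C_ED \<ge> 1" and "0 < \<delta>_ED" and "\<delta>_ED < 1"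
  shows "\<exists>C. \<forall>\<nu> (V :: real \<Rightarrow> real^('n::finite + 'n) \<Rightarrow> real^('n + 'n)) F W M \<omega>.
    0 < \<nu> \<and> \<nu> \<le> 1 \<and>
    alternating_sine_shear A \<nu> V \<and> enhanced_dissipation \<nu> V C_ED \<delta>_ED \<and>
    F = (\<lambda>x. exp (- W x)) \<and> torus_periodic F \<and> C_diff 3 F \<and> (\<forall>x. F x \<ge> 1) \<and>
    M = L1_norm F \<and> weighted_solution \<nu> V W \<omega> \<longrightarrow>
    (\<forall>t\<ge>0. L2_norm (\<lambda>x. \<omega> t x * exp (- W x) - M)
       \<le> C * L2_norm (\<lambda>x. torus_volume TYPE('n + 'n) * exp (- W x) - M)
           * exp (- \<delta>_ED * sqrt \<nu> * t))"
proof (intro exI[of _ C_ED] allI impI, elim conjE)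
  fix \<nu> and V :: "real \<Rightarrow> real^('n + 'n) \<Rightarrow> real^('n + 'n)" and F W M \<omega> and t :: real
  assume V: "alternating_sine_shear A \<nu> V" and ed: "enhanced_dissipation \<nu> V C_ED \<delta>_ED"
    and F: "F = (\<lambda>x. exp (- W x))" "torus_periodic F" "C_diff 3 F"
    and M: "M = L1_norm F" and \<omega>: "weighted_solution \<nu> V W \<omega>" and "t \<ge> 0"
  let ?\<eta> = "\<lambda>t x. \<omega> t x * exp (- W x)" and ?v = "torus_volume TYPE('n + 'n)"
  have "C_diff 2 F"
    by (rule C_diff_SucD) (use F(3) in \<open>simp add: numeral_2_eq_2 numeral_3_eq_3\<close>)
  then have \<eta>: "passive_scalar_solution \<nu> V ?\<eta>"
    using weighted_solution_imp_passive_scalar[OF \<omega>] F by simp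
  have \<eta>0: "?\<eta> 0 = (\<lambda>x. ?v * exp (- W x))"
    using \<omega> by (simp add: weighted_solution_def)
  \<comment> \<open>The initial value \<open>?v\<close> of \<omega> cancels the volume in the
    definition of the mean, and \<open>exp\<close> is positive, so the L1 norm of \<open>F\<close>
    is its integral.\<close>
  then have "torus_mean (?\<eta> 0) = M"
    using torus_volume_pos[where 'd = "'n + 'n"] by (simp add: torus_mean_def M L1_norm_def F(1))
  then have mean: "torus_mean (?\<eta> s) = M" if "s \<ge> 0" for s
    using torus_mean_passive_scalar[OF V \<eta> that] by simp
  \<comment> \<open>Enhanced dissipation is applied from the starting time 0; the sum
    \<open>0 + t\<close> keeps the shape of its definition.\<close>
  have "L2_norm (\<lambda>x. ?\<eta> (0 + t) x - torus_mean (?\<eta> (0 + t)))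
      \<le> C_ED * L2_norm (\<lambda>x. ?\<eta> 0 x - torus_mean (?\<eta> 0)) * exp (- \<delta>_ED * sqrt \<nu> * t)"
    using ed \<eta> \<open>t \<ge> 0\<close> unfolding enhanced_dissipation_def by blast
  then show "L2_norm (\<lambda>x. \<omega> t x * exp (- W x) - M)
      \<le> C_ED * L2_norm (\<lambda>x. ?v * exp (- W x) - M) * exp (- \<delta>_ED * sqrt \<nu> * t)"
    using mean[OF \<open>t \<ge> 0\<close>] mean[of 0] \<eta>0 by (simp add: fun_eq_iff)
qed

end
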